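(* Let $A$ be a nonempty set, $\mathbb{F}$ a field, and $\mathscr{N}[A]$ the free non-associative $\mathbb{F}$-algebra on $A$. Let $S$ be a homogeneous subalgebra of $\mathscr{N}[A]$ and let $\alpha_S \subset S$ be an algebraically independent set of homogeneous $A$-polynomials which is of bounded degree. If $$\{p \in S : \deg(p) \leq \deg(\alpha_S)\} \subset \langle \alpha_S \rangle,$$ then there exists an algebraically independent set $\alpha \subset S$ of homogeneous $A$-polynomials such that $$\alpha_S \subset \alpha \quad\text{and}\quad \langle \alpha \rangle = S.$$
   Context: An $\mathbb{F}$-algebra is an $\mathbb{F}$-vector space with a bilinear product (not assumed associative, commutative or unital). $\mathscr{M}[A]$ is the free magma on $A$; its elements are called $A$-monomials. The degree of an $A$-monomial is the positive integer determined by $\deg(a)=1$ for $a\in A$ and $\deg((m_1,m_2))=\deg(m_1)+\deg(m_2)$, where $(m_1,m_2)$ denotes the product. $\mathscr{N}[A]$ is the $\mathbb{F}$-vector space with basis $\mathscr{M}[A]$ with the bilinear product extending that of $\mathscr{M}[A]$; its elements are called $A$-polynomials. The degree $\deg(p)$ of a nonzero $A$-polynomial $p$ is the largest degree of an $A$-monomial occurring in $p$ with nonzero coefficient; the degree of $0$ is undefined. $\mathscr{H}_n[A]$ is the span of the $A$-monomials of degree $n$, so $\mathscr{N}[A]=\bigoplus_{n\ge1}\mathscr{H}_n[A]$; nonzero elements of $\mathscr{H}_n[A]$ are called homogeneous $A$-polynomials of degree $n$, and $\pi_n:\mathscr{N}[A]\to\mathscr{H}_n[A]$ is the canonical projection.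 A subalgebra $S$ of $\mathscr{N}[A]$ is homogeneous if $\pi_n(p)\in S$ for every positive integer $n$ and every $p\in S$. For indeterminates $X_1,\dots,X_n$, elements of $\mathscr{N}[X_1,\dots,X_n]$ (the free non-associative $\mathbb{F}$-algebra on $\{X_1,\dots,X_n\}$) are called polynomials. For elements $y_1,\dots,y_n$ of an $\mathbb{F}$-algebra $\mathscr{A}$, $P(y_1,\dots,y_n)$ is the image of $P$ under the unique algebra homomorphism $\mathscr{N}[X_1,\dots,X_n]\to\mathscr{A}$ with $X_i\mapsto y_i$. A subset $\alpha\subset\mathscr{A}$ is algebraically independent if for every $n \geq 1$, all distinct $y_1,\dots,y_n\in\alpha$ and every $P\in\mathscr{N}[X_1,\dots,X_n]$, $P(y_1,\dots,y_n)=0$ implies $P=0$. $\langle G\rangle$ denotes the subalgebra generated by $G$ (so $\langle\emptyset\rangle=\{0\}$). A subset $T$ of $\mathscr{N}[A]$ is of bounded degree if there is a positive integer $N$ with $\deg(p)\le N$ for all nonzero $p\in T$. If $T$ is nonempty and of bounded degree, $\deg(T)$ denotes the smallest such $N$; $\deg(\emptyset)=0$. *)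

theory Defs
  imports Complex_Main "HOL-Library.Poly_Mapping"
begin

locale nonassoc_algebra = vector_space scale
  for scale :: "'f::field \<Rightarrow> 'v::ab_group_add \<Rightarrow> 'v" +
  fixes prd :: "'v \<Rightarrow> 'v \<Rightarrow> 'v"
  assumes prd_add_left: "prd (x + y) z = prd x z + prd y z"
    and prd_add_right: "prd x (y + z) = prd x y + prd x z"
    and prd_scale_left: "prd (scale c x) y = scale c (prd x y)"
    and prd_scale_right: "prd x (scale c y) = scale c (prd x y)"
begin

definition subalgebra :: "'v set \<Rightarrow> bool" where
  "subalgebra S \<longleftrightarrow> subspace S \<and> (\<forall>x\<in>S. \<forall>y\<in>S. prd x y \<in> S)"

text \<open>Carriers are subsets of the type \<open>'v\<close>. If \<open>G\<close> lies in a subalgebra \<open>B\<close>, then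
  \<open>generated G\<close> is also the smallest subalgebra of \<open>B\<close> containing \<open>G\<close>.\<close>

definition generated :: "'v set \<Rightarrow> 'v set" where
  "generated G = subalgebra hull G"

lemma prd_zero_left [simp]: "prd 0 y = 0"
  using prd_add_left[of 0 0 y] by simp

lemma prd_zero_right [simp]: "prd x 0 = 0"
  using prd_add_right[of x 0 0] by simp

lemma prd_sum_left: "prd (sum f I) y = (\<Sum>i\<in>I. prd (f i) y)"
  by (induction I rule: infinite_finite_induct) (auto simp: prd_add_left)

lemma prd_sum_right: "prd x (sum f I) = (\<Sum>i\<in>I. prd x (f i))"
  by (induction I rule: infinite_finite_induct) (auto simp: prd_add_right)

lemma subalgebra_generated: "subalgebra (generated G)"
  unfolding generated_def by (rule hull_in) (auto simp: subalgebra_def intro: subspace_Inter)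

lemma generated_empty: "generated {} = {0}"
proof -
  have "subalgebra {0}" by (auto simp: subalgebra_def subspace_def)
  then have "generated {} \<subseteq> {0}" unfolding generated_def by (simp add: hull_minimal)
  moreover have "0 \<in> generated {}"
    using subalgebra_generated[of "{}"] by (simp add: subalgebra_def subspace_def)
  ultimately show ?thesis by auto
qed

end

datatype (gens: 'a) magma = Gen 'a | Mul "'a magma" "'a magma"

primrec mdeg :: "'a magma \<Rightarrow> nat" where
  "mdeg (Gen a) = 1"
| "mdeg (Mul m n) = mdeg m + mdeg n"

definition monomials :: "'a set \<Rightarrow> 'a magma set" where
  "monomials A = {m. gens m \<subseteq> A}"

type_synonym ('a, 'f) npoly = "'a magma \<Rightarrow>\<^sub>0 'f"

definition nscale :: "'f::field \<Rightarrow> ('a, 'f) npoly \<Rightarrow> ('a, 'f) npoly" where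
  "nscale c p = Poly_Mapping.map ((*) c) p"

definition nmult :: "('a, 'f::field) npoly \<Rightarrow> ('a, 'f) npoly \<Rightarrow> ('a, 'f) npoly" where
  "nmult p q = (\<Sum>m\<in>Poly_Mapping.keys p. \<Sum>n\<in>Poly_Mapping.keys q.
      Poly_Mapping.single (Mul m n) (Poly_Mapping.lookup p m * Poly_Mapping.lookup q n))"

lemma lookup_nscale [simp]: "Poly_Mapping.lookup (nscale c p) m = c * Poly_Mapping.lookup p m"
  by (simp add: nscale_def Poly_Mapping.map.rep_eq when_def)

lemma lookup_nmult_Gen [simp]: "Poly_Mapping.lookup (nmult p q) (Gen a) = 0"
  by (simp add: nmult_def lookup_sum lookup_single)

lemma lookup_nmult_Mul [simp]:
  "Poly_Mapping.lookup (nmult p q) (Mul m n) = Poly_Mapping.lookup p m * Poly_Mapping.lookup q n"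
proof -
  let ?f = "\<lambda>m' n'. Poly_Mapping.lookup p m' * Poly_Mapping.lookup q n'"
  have "Poly_Mapping.lookup (nmult p q) (Mul m n) =
     (\<Sum>m'\<in>Poly_Mapping.keys p. \<Sum>n'\<in>Poly_Mapping.keys q.
        if n' = n then (if m' = m then ?f m' n' else 0) else 0)"
    by (auto simp: nmult_def lookup_sum lookup_single when_def intro!: sum.cong)
  also have "\<dots> = (\<Sum>m'\<in>Poly_Mapping.keys p. if m' = m then ?f m' n else 0)"
    by (intro sum.cong refl) (auto simp: sum.delta in_keys_iff)
  also have "\<dots> = ?f m n"
    by (simp add: sum.delta in_keys_iff)
  finally show ?thesis .
qed

global_interpretation free_alg: nonassoc_algebra
  "nscale :: 'f::field \<Rightarrow> ('a, 'f) npoly \<Rightarrow> ('a, 'f) npoly" nmult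
proof
  fix x y z :: "('a, 'f) npoly" and c d :: 'f
  show "nscale c (x + y) = nscale c x + nscale c y"
    by (rule poly_mapping_eqI) (simp add: lookup_add algebra_simps)
  show "nscale (c + d) x = nscale c x + nscale d x"
    by (rule poly_mapping_eqI) (simp add: lookup_add algebra_simps)
  show "nscale c (nscale d x) = nscale (c * d) x"
    by (rule poly_mapping_eqI) (simp add: algebra_simps)
  show "nscale 1 x = x"
    by (rule poly_mapping_eqI) simp
  have eqI: "p = q" if "\<And>a. Poly_Mapping.lookup p (Gen a) = Poly_Mapping.lookup q (Gen a)"
    "\<And>m n. Poly_Mapping.lookup p (Mul m n) = Poly_Mapping.lookup q (Mul m n)"
    for p q :: "('a, 'f) npoly"
  proof (rule poly_mapping_eqI)
    fix k show "Poly_Mapping.lookup p k = Poly_Mapping.lookup q k"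
      using that by (cases k) auto
  qed
  show "nmult (x + y) z = nmult x z + nmult y z"
    by (rule eqI) (simp_all add: lookup_add algebra_simps)
  show "nmult x (y + z) = nmult x y + nmult x z"
    by (rule eqI) (simp_all add: lookup_add algebra_simps)
  show "nmult (nscale c x) y = nscale c (nmult x y)"
    by (rule eqI) (simp_all add: algebra_simps)
  show "nmult x (nscale c y) = nscale c (nmult x y)"
    by (rule eqI) (simp_all add: algebra_simps)
qed

definition NA :: "'a set \<Rightarrow> ('a, 'f::field) npoly set" where
  "NA A = {p. Poly_Mapping.keys p \<subseteq> monomials A}"

lemma subalgebra_NA: "free_alg.subalgebra (NA A :: ('a, 'f::field) npoly set)"
proof -
  have "nmult p q \<in> NA A" if "p \<in> NA A" "q \<in> NA A" for p q :: "('a, 'f) npoly"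
  proof -
    have "m \<in> monomials A" if m: "Poly_Mapping.lookup (nmult p q) m \<noteq> 0" for m
      using m \<open>p \<in> NA A\<close> \<open>q \<in> NA A\<close>
      by (cases m) (auto simp: NA_def monomials_def in_keys_iff subset_iff)
    then show ?thesis by (auto simp: NA_def in_keys_iff)
  qed
  moreover have "p + q \<in> NA A" if "p \<in> NA A" "q \<in> NA A" for p q :: "('a, 'f) npoly"
    using that Poly_Mapping.keys_add[of p q] by (auto simp: NA_def)
  moreover have "nscale c p \<in> NA A" if "p \<in> NA A" for c and p :: "('a, 'f) npoly"
    using that by (auto simp: NA_def in_keys_iff)
  moreover have "(0 :: ('a, 'f) npoly) \<in> NA A"
    by (simp add: NA_def)
  ultimately show ?thesis
    unfolding free_alg.subalgebra_def free_alg.subspace_def by blast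
qed

lemma npoly_expand:
  "p = (\<Sum>m\<in>Poly_Mapping.keys p. nscale (Poly_Mapping.lookup p m) (Poly_Mapping.single m 1))"
  for p :: "('a, 'f::field) npoly"
  by (rule poly_mapping_eqI) (simp add: lookup_sum lookup_single when_def sum.delta' in_keys_iff
      if_distrib cong: if_cong)

context nonassoc_algebra
begin

primrec eval_monomial :: "('i \<Rightarrow> 'v) \<Rightarrow> 'i magma \<Rightarrow> 'v" where
  "eval_monomial y (Gen i) = y i"
| "eval_monomial y (Mul m n) = prd (eval_monomial y m) (eval_monomial y n)"

text \<open>The image of \<open>P\<close> under the homomorphism sending each generator \<open>i\<close> to \<open>y i\<close>;
  see \<open>eval_npoly_linear\<close>, \<open>eval_npoly_nmult\<close>, \<open>eval_npoly_Gen\<close> and \<open>eval_npoly_unique\<close> below.\<close>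

definition eval_npoly :: "('i \<Rightarrow> 'v) \<Rightarrow> ('i, 'f) npoly \<Rightarrow> 'v" where
  "eval_npoly y P =
     (\<Sum>m\<in>Poly_Mapping.keys P. scale (Poly_Mapping.lookup P m) (eval_monomial y m))"

lemma eval_npoly_superset:
  assumes "finite K" "Poly_Mapping.keys P \<subseteq> K"
  shows "eval_npoly y P = (\<Sum>m\<in>K. scale (Poly_Mapping.lookup P m) (eval_monomial y m))"
  unfolding eval_npoly_def by (rule sum.mono_neutral_left) (use assms in \<open>auto simp: in_keys_iff\<close>)

lemma eval_npoly_add: "eval_npoly y (P + Q) = eval_npoly y P + eval_npoly y Q"
proof -
  let ?K = "Poly_Mapping.keys P \<union> Poly_Mapping.keys Q"
  have K: "finite ?K" "Poly_Mapping.keys (P + Q) \<subseteq> ?K" by (simp_all add: Poly_Mapping.keys_add)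
  show ?thesis
    by (simp add: eval_npoly_superset[OF K(1)] K(2) lookup_add scale_left_distrib sum.distrib)
qed

lemma eval_npoly_nscale: "eval_npoly y (nscale c P) = scale c (eval_npoly y P)"
proof -
  have "Poly_Mapping.keys (nscale c P) \<subseteq> Poly_Mapping.keys P" by (auto simp: in_keys_iff)
  then show ?thesis
    by (simp add: eval_npoly_superset[of "Poly_Mapping.keys P"] scale_sum_right)
qed

lemma eval_npoly_single: "eval_npoly y (Poly_Mapping.single m c) = scale c (eval_monomial y m)"
  by (simp add: eval_npoly_superset[of "{m}"])

lemma eval_npoly_sum: "eval_npoly y (sum f I) = (\<Sum>i\<in>I. eval_npoly y (f i))"
proof (induction I rule: infinite_finite_induct)
  case (insert x F) then show ?case by (simp add: eval_npoly_add)
qed (simp_all add: eval_npoly_def)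

lemma eval_npoly_nmult: "eval_npoly y (nmult P Q) = prd (eval_npoly y P) (eval_npoly y Q)"
proof -
  have "eval_npoly y (nmult P Q) =
      (\<Sum>m\<in>Poly_Mapping.keys P. \<Sum>n\<in>Poly_Mapping.keys Q.
        scale (Poly_Mapping.lookup P m * Poly_Mapping.lookup Q n)
          (prd (eval_monomial y m) (eval_monomial y n)))"
    by (simp add: nmult_def eval_npoly_sum eval_npoly_single)
  also have "\<dots> = prd (eval_npoly y P) (eval_npoly y Q)"
    unfolding eval_npoly_def prd_sum_left
    by (simp add: prd_sum_right prd_scale_left prd_scale_right scale_sum_right mult.commute)
  finally show ?thesis .
qed

lemma eval_npoly_linear: "Vector_Spaces.linear nscale scale (eval_npoly y)"
  by (simp add: Vector_Spaces.linear_def module_hom_def module_hom_axioms_def eval_npoly_add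
      eval_npoly_nscale vector_space_axioms free_alg.vector_space_axioms
      module_axioms free_alg.module_axioms)

lemma eval_npoly_Gen: "eval_npoly y (Poly_Mapping.single (Gen i) 1) = y i"
  by (simp add: eval_npoly_single)

lemma eval_npoly_unique:
  fixes h :: "('i, 'f) npoly \<Rightarrow> 'v"
  assumes add: "\<And>p q. p \<in> NA I \<Longrightarrow> q \<in> NA I \<Longrightarrow> h (p + q) = h p + h q"
    and scl: "\<And>c p. p \<in> NA I \<Longrightarrow> h (nscale c p) = scale c (h p)"
    and mul: "\<And>p q. p \<in> NA I \<Longrightarrow> q \<in> NA I \<Longrightarrow> h (nmult p q) = prd (h p) (h q)"
    and gen: "\<And>i. i \<in> I \<Longrightarrow> h (Poly_Mapping.single (Gen i) 1) = y i"
    and P: "P \<in> NA I"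
  shows "h P = eval_npoly y P"
proof -
  have zero: "h 0 = 0"
    using add[of 0 0] by (simp add: NA_def)
  have single: "Poly_Mapping.single m c \<in> NA I" if "m \<in> monomials I" for m and c :: 'f
    using that by (auto simp: NA_def)
  have mono: "h (Poly_Mapping.single m 1) = eval_monomial y m" if "m \<in> monomials I" for m
    using that
  proof (induction m)
    case (Gen i) then show ?case by (simp add: gen monomials_def)
  next
    case (Mul m n)
    then have mn: "m \<in> monomials I" "n \<in> monomials I" by (auto simp: monomials_def)
    have "nmult (Poly_Mapping.single m 1) (Poly_Mapping.single n (1::'f))
        = Poly_Mapping.single (Mul m n) 1"
      by (simp add: nmult_def)
    then show ?case
      using mul[OF single[OF mn(1), of 1] single[OF mn(2), of 1]] Mul.IH mn by simp
  qed
  have "h (\<Sum>m\<in>K. nscale (Poly_Mapping.lookup P m) (Poly_Mapping.single m 1))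
      = (\<Sum>m\<in>K. scale (Poly_Mapping.lookup P m) (eval_monomial y m)) \<and>
      (\<Sum>m\<in>K. nscale (Poly_Mapping.lookup P m) (Poly_Mapping.single m 1)) \<in> NA I"
    if "finite K" "K \<subseteq> monomials I" for K
    using that
  proof (induction K)
    case empty then show ?case by (simp add: zero NA_def)
  next
    case (insert m K)
    have "nscale (Poly_Mapping.lookup P m) (Poly_Mapping.single m 1) \<in> NA I"
      using insert.prems single[of m 1] subalgebra_NA[where 'f='f, of I]
      by (simp add: free_alg.subalgebra_def free_alg.subspace_def)
    moreover have "p + q \<in> NA I" if "p \<in> NA I" "q \<in> NA I" for p q :: "('i, 'f) npoly"
      using that subalgebra_NA[where 'f='f, of I]
      by (simp add: free_alg.subalgebra_def free_alg.subspace_def)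
    ultimately show ?case
      using insert by (simp add: add scl single mono)
  qed
  from this[of "Poly_Mapping.keys P"] show ?thesis
    using P by (simp add: npoly_expand[symmetric] eval_npoly_def NA_def)
qed

text \<open>The indeterminates \<open>X\<^sub>1, \<dots>, X\<^sub>n\<close> are the generators \<open>1, \<dots>, n\<close>.\<close>

definition alg_independent :: "'v set \<Rightarrow> bool" where
  "alg_independent \<alpha> \<longleftrightarrow>
     (\<forall>n\<ge>1. \<forall>y :: nat \<Rightarrow> 'v. inj_on y {1..n} \<and> y ` {1..n} \<subseteq> \<alpha> \<longrightarrow>
       (\<forall>P \<in> NA {1..n}. eval_npoly y P = 0 \<longrightarrow> P = 0))"

end

text \<open>\<open>pdeg 0\<close> is the unspecified value \<open>Max {}\<close>; \<open>pdeg\<close> is only used below for nonzero arguments.\<close>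

definition pdeg :: "('a, 'f::field) npoly \<Rightarrow> nat" where
  "pdeg p = Max (mdeg ` Poly_Mapping.keys p)"

definition HA :: "nat \<Rightarrow> 'a set \<Rightarrow> ('a, 'f::field) npoly set" where
  "HA n A = free_alg.span {Poly_Mapping.single m 1 | m. m \<in> monomials A \<and> mdeg m = n}"

definition homogeneous_poly :: "'a set \<Rightarrow> ('a, 'f::field) npoly \<Rightarrow> bool" where
  "homogeneous_poly A p \<longleftrightarrow> (\<exists>n\<ge>1. p \<in> HA n A \<and> p \<noteq> 0)"

definition hproj :: "nat \<Rightarrow> ('a, 'f::field) npoly \<Rightarrow> ('a, 'f) npoly" where
  "hproj n p = (\<Sum>m\<in>{m \<in> Poly_Mapping.keys p. mdeg m = n}.
      Poly_Mapping.single m (Poly_Mapping.lookup p m))"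

lemma mdeg_pos: "mdeg m \<ge> 1"
  by (induction m) auto

lemma hproj_mem: "p \<in> NA A \<Longrightarrow> hproj n p \<in> HA n A"
  unfolding hproj_def HA_def
proof (rule free_alg.span_sum)
  fix m assume "p \<in> NA A" and m: "m \<in> {m \<in> Poly_Mapping.keys p. mdeg m = n}"
  then have "Poly_Mapping.single m (1::'b) \<in>
      free_alg.span {Poly_Mapping.single m 1 | m. m \<in> monomials A \<and> mdeg m = n}"
    by (intro free_alg.span_base) (auto simp: NA_def)
  from free_alg.span_scale[OF this, of "Poly_Mapping.lookup p m"]
  have "nscale (Poly_Mapping.lookup p m) (Poly_Mapping.single m 1) \<in>
      free_alg.span {Poly_Mapping.single m 1 | m. m \<in> monomials A \<and> mdeg m = n}" .
  moreover have "nscale c (Poly_Mapping.single m 1) = Poly_Mapping.single m c" for c :: 'b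
    by (rule poly_mapping_eqI) (simp add: lookup_single when_def)
  ultimately show "Poly_Mapping.single m (Poly_Mapping.lookup p m) \<in>
      free_alg.span {Poly_Mapping.single m 1 | m. m \<in> monomials A \<and> mdeg m = n}" by simp
qed

lemma lookup_hproj:
  "Poly_Mapping.lookup (hproj n p) m = (if mdeg m = n then Poly_Mapping.lookup p m else 0)"
  by (simp add: hproj_def lookup_sum lookup_single when_def sum.delta in_keys_iff)

lemma hproj_sum: "p \<noteq> 0 \<Longrightarrow> p = (\<Sum>n=1..pdeg p. hproj n p)"
proof (rule poly_mapping_eqI)
  fix m
  have "Poly_Mapping.lookup p m = 0 \<or> mdeg m \<le> pdeg p"
    by (cases "m \<in> Poly_Mapping.keys p") (auto simp: pdeg_def in_keys_iff)
  then show "Poly_Mapping.lookup p m = Poly_Mapping.lookup (\<Sum>n=1..pdeg p. hproj n p) m"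
    using mdeg_pos[of m] by (auto simp: lookup_sum lookup_hproj)
qed

definition homogeneous_subalgebra :: "'a set \<Rightarrow> ('a, 'f::field) npoly set \<Rightarrow> bool" where
  "homogeneous_subalgebra A S \<longleftrightarrow> free_alg.subalgebra S \<and> S \<subseteq> NA A \<and>
     (\<forall>n\<ge>1. \<forall>p\<in>S. hproj n p \<in> S)"

definition bounded_degree :: "('a, 'f::field) npoly set \<Rightarrow> bool" where
  "bounded_degree T \<longleftrightarrow> (\<exists>N\<ge>1. \<forall>p\<in>T. p \<noteq> 0 \<longrightarrow> pdeg p \<le> N)"

definition set_deg :: "('a, 'f::field) npoly set \<Rightarrow> nat" where
  "set_deg T = (if T = {} then 0 else LEAST N. N \<ge> 1 \<and> (\<forall>p\<in>T. p \<noteq> 0 \<longrightarrow> pdeg p \<le> N))"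

end

theory Submission
  imports Defs
begin

text \<open>
  The argument turns algebraic independence, a condition on all polynomials, into linear
  independence modulo a subspace, and then extends \<open>\<alpha>\<^sub>S\<close> by the basis extension theorem.
  Write \<open>S\<^sup>2\<close> for the span of the products of two elements of \<open>S\<close>.

  A subset \<open>\<alpha>\<close> of the free algebra is algebraically independent exactly when it is linearly independent modulo
  \<open>\<langle>\<alpha>\<rangle>\<^sup>2\<close>. One direction holds in every algebra
  (\<open>alg_independent_imp_independent_mod_square\<close>): an element of \<open>\<langle>\<alpha>\<rangle>\<^sup>2\<close> is the value of a
  polynomial without linear terms, so a linear combination of \<open>\<alpha>\<close> lying in \<open>\<langle>\<alpha>\<rangle>\<^sup>2\<close> would give
  a polynomial relation. The converse (\<open>independent_mod_square_imp_alg_independent\<close>) is where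
  freeness enters: a monomial of the free magma factors uniquely, so the product embeds the
  tensor square of the free algebra into the free algebra. In a polynomial relation the linear
  terms vanish by hypothesis; grouping the rest by left factors and cancelling
  them (\<open>nmult_sum_eq_0\<close>) leaves relations of smaller degree.

  If \<open>\<alpha>\<^sub>S\<close> generates all of \<open>S\<close> up to a degree bounding \<open>\<alpha>\<^sub>S\<close>, then \<open>\<alpha>\<^sub>S\<close> is linearly
  independent even modulo the possibly larger space \<open>S\<^sup>2\<close>
  (\<open>independent_mod_square_subalgebra\<close>): in these degrees the components of \<open>S\<^sup>2\<close> are sums of
  products of elements of \<open>S\<close> of still smaller degree, which lie in \<open>\<langle>\<alpha>\<^sub>S\<rangle>\<close>.

  So \<open>\<alpha>\<^sub>S\<close> extends to a maximal set \<open>\<alpha>\<close> of homogeneous elements of \<open>S\<close> that is linearly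
  independent modulo \<open>S\<^sup>2\<close>. Maximality means that every homogeneous element of \<open>S\<close> is a
  linear combination of \<open>\<alpha>\<close> up to products of elements of \<open>S\<close>; taking components of one
  degree makes the factors of those products have smaller degree, and induction gives
  \<open>\<langle>\<alpha>\<rangle> = S\<close> (\<open>generated_eq_homogeneous_subalgebra\<close>). Now \<open>S\<^sup>2 = \<langle>\<alpha>\<rangle>\<^sup>2\<close>, so the criterion
  above shows that \<open>\<alpha>\<close> is algebraically independent.
\<close>

section \<open>Linear independence modulo a subspace\<close>

context nonassoc_algebra
begin

definition independent_mod :: "'v set \<Rightarrow> 'v set \<Rightarrow> bool" where
  "independent_mod D B \<longleftrightarrow>
     (\<forall>T c. finite T \<and> T \<subseteq> B \<and> (\<Sum>t\<in>T. scale (c t) t) \<in> D \<longrightarrow> (\<forall>t\<in>T. c t = 0))"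

lemma independent_modD:
  assumes "independent_mod D B" "finite T" "T \<subseteq> B" "(\<Sum>t\<in>T. scale (c t) t) \<in> D" "t \<in> T"
  shows "c t = 0"
  using assms unfolding independent_mod_def by blast

lemma independent_mod_disjoint:
  assumes "independent_mod D B"
  shows "B \<inter> D = {}"
proof -
  have "t \<notin> D" if "t \<in> B" for t
    using independent_modD[OF assms, of "{t}" "\<lambda>_. 1"] that by auto
  then show ?thesis by blast
qed

text \<open>Once a basis \<open>E\<close> of the subspace is fixed, independence modulo the subspace is ordinary
  linear independence together with \<open>E\<close>, so results on bases apply.\<close>

lemma independent_mod_iff_independent_Un:
  assumes "independent E" "B \<inter> E = {}"
  shows "independent_mod (span E) B \<longleftrightarrow> independent (B \<union> E)"
proof
  assume B: "independent_mod (span E) B"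
  show "independent (B \<union> E)"
    unfolding independent_explicit_module
  proof (intro allI impI)
    fix T u v
    assume T: "finite T" "T \<subseteq> B \<union> E" "(\<Sum>v\<in>T. scale (u v) v) = 0" "v \<in> T"
    have "(\<Sum>v\<in>T \<inter> E. scale (u v) v) + (\<Sum>v\<in>T - E. scale (u v) v) = 0"
      using T(3) sum.Int_Diff[OF T(1), of "\<lambda>v. scale (u v) v" E] by simp
    then have eq: "(\<Sum>v\<in>T - E. scale (u v) v) = - (\<Sum>v\<in>T \<inter> E. scale (u v) v)"
      by (simp add: eq_neg_iff_add_eq_0 add.commute)
    have "(\<Sum>v\<in>T - E. scale (u v) v) \<in> span E"
      unfolding eq by (intro span_neg span_sum span_scale span_base) auto
    then have zero: "\<forall>v\<in>T - E. u v = 0"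
      using independent_modD[OF B, of "T - E" u] T(1,2) by auto
    then have "(\<Sum>v\<in>T \<inter> E. scale (u v) v) = 0"
      using eq by simp
    then have "\<forall>v\<in>T \<inter> E. u v = 0"
      using assms(1) T(1) unfolding independent_explicit_module by (meson finite_Int inf_le2)
    with zero T(4) show "u v = 0" by blast
  qed
next
  assume ind: "independent (B \<union> E)"
  show "independent_mod (span E) B"
    unfolding independent_mod_def
  proof (intro allI impI ballI)
    fix T c t
    assume T: "finite T \<and> T \<subseteq> B \<and> (\<Sum>t\<in>T. scale (c t) t) \<in> span E" and t: "t \<in> T"
    then obtain F r where F: "finite F" "F \<subseteq> E"
      "(\<Sum>t\<in>T. scale (c t) t) = (\<Sum>e\<in>F. scale (r e) e)"
      unfolding span_explicit by auto
    define u where "u = (\<lambda>v. if v \<in> F then - r v else c v)"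
    have disj: "T \<inter> F = {}" using T F(2) assms(2) by blast
    have "(\<Sum>v\<in>T \<union> F. scale (u v) v)
        = (\<Sum>v\<in>T. scale (u v) v) + (\<Sum>v\<in>F. scale (u v) v)"
      using T F(1) disj by (intro sum.union_disjoint) auto
    also have "(\<Sum>v\<in>T. scale (u v) v) = (\<Sum>v\<in>T. scale (c v) v)"
      using disj by (intro sum.cong) (auto simp: u_def)
    also have "(\<Sum>v\<in>F. scale (u v) v) = - (\<Sum>v\<in>F. scale (r v) v)"
      by (simp add: u_def sum_negf)
    finally have "(\<Sum>v\<in>T \<union> F. scale (u v) v) = 0"
      using F(3) by simp
    moreover have "finite (T \<union> F)" "T \<union> F \<subseteq> B \<union> E" "t \<in> T \<union> F"
      using T F t by auto
    ultimately have "u t = 0"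
      using ind unfolding independent_explicit_module by blast
    then show "c t = 0"
      using t disj by (auto simp: u_def split: if_splits)
  qed
qed

text \<open>Adjoin a basis \<open>E\<close> of \<open>D\<close> to \<open>B0\<close>, extend the union to a basis of the span of \<open>H \<union> E\<close>
  inside \<open>H \<union> E\<close>, and discard \<open>E\<close> again.\<close>

lemma independent_mod_extend:
  assumes D: "subspace D" and B0: "independent_mod D B0" and sub: "B0 \<subseteq> H"
  obtains B where "B0 \<subseteq> B" "B \<subseteq> H" "independent_mod D B" "H \<subseteq> span (B \<union> D)"
proof -
  obtain E where E: "E \<subseteq> D" "independent E" "D \<subseteq> span E"
    by (rule maximal_independent_subset)
  have D_eq: "D = span E"
    using E D by (metis span_minimal subset_antisym)
  have disj0: "B0 \<inter> E = {}"
    using independent_mod_disjoint[OF B0] E(1) by blast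
  have "independent (B0 \<union> E)"
    using independent_mod_iff_independent_Un[OF E(2) disj0] B0 D_eq by simp
  moreover have "B0 \<union> E \<subseteq> H \<union> E" using sub by blast
  ultimately obtain C where
    C: "B0 \<union> E \<subseteq> C" "C \<subseteq> H \<union> E" "independent C" "H \<union> E \<subseteq> span C"
    using maximal_independent_subset_extend by metis
  have C_eq: "(C - E) \<union> E = C" using C(1) by blast
  show thesis
  proof
    show "B0 \<subseteq> C - E" using C(1) disj0 by blast
    show "C - E \<subseteq> H" using C(2) by blast
    show "independent_mod D (C - E)"
      unfolding D_eq using independent_mod_iff_independent_Un[OF E(2), of "C - E"] C(3) C_eq by auto
    have "span C \<subseteq> span ((C - E) \<union> D)"
      using E(1) C_eq by (intro span_mono) blast
    then show "H \<subseteq> span ((C - E) \<union> D)" using C(4) by blast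
  qed
qed

end

section \<open>Polynomials evaluated at algebraically independent elements\<close>

context nonassoc_algebra
begin

definition square :: "'v set \<Rightarrow> 'v set" where
  "square S = span {prd x y | x y. x \<in> S \<and> y \<in> S}"

lemma subspace_square: "subspace (square S)"
  by (simp add: square_def)

lemma prd_in_square: "x \<in> S \<Longrightarrow> y \<in> S \<Longrightarrow> prd x y \<in> square S"
  unfolding square_def by (rule span_base) blast

lemma generated_superset: "G \<subseteq> generated G"
  unfolding generated_def by (rule hull_subset)

lemma generated_minimal: "G \<subseteq> B \<Longrightarrow> subalgebra B \<Longrightarrow> generated G \<subseteq> B"
  unfolding generated_def by (rule hull_minimal)

lemma square_subset_subalgebra: "subalgebra S \<Longrightarrow> square S \<subseteq> S"
  unfolding square_def by (rule span_minimal) (auto simp: subalgebra_def)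

lemma eval_monomial_cong:
  "(\<And>i. i \<in> gens m \<Longrightarrow> y i = z i) \<Longrightarrow> eval_monomial y m = eval_monomial z m"
  by (induction m) auto

lemma eval_npoly_cong:
  assumes "P \<in> NA I" "\<And>i. i \<in> I \<Longrightarrow> y i = z i"
  shows "eval_npoly y P = eval_npoly z P"
  unfolding eval_npoly_def using assms
  by (intro sum.cong refl arg_cong[where f = "scale _"] eval_monomial_cong)
     (auto simp: NA_def monomials_def)

lemma eval_npoly_0 [simp]: "eval_npoly y 0 = 0"
  by (simp add: eval_npoly_def)

text \<open>Both sides are homomorphisms in \<open>P\<close> with the same values on the generators. This allows
  indeterminates to be renamed.\<close>

lemma eval_npoly_substitute:
  "eval_npoly y (free_alg.eval_npoly z P) = eval_npoly (\<lambda>i. eval_npoly y (z i)) P"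
proof -
  have "eval_npoly y (free_alg.eval_monomial z m) = eval_monomial (\<lambda>i. eval_npoly y (z i)) m" for m
    by (induction m) (simp_all add: eval_npoly_nmult)
  then show ?thesis
    by (simp add: free_alg.eval_npoly_def eval_npoly_def[of _ P] eval_npoly_sum eval_npoly_nscale)
qed

lemma eval_npoly_in_subalgebra:
  assumes S: "subalgebra S" and P: "P \<in> NA I" and y: "\<And>i. i \<in> I \<Longrightarrow> y i \<in> S"
  shows "eval_npoly y P \<in> S"
proof -
  have "eval_monomial y m \<in> S" if "gens m \<subseteq> I" for m
    using that S y by (induction m) (auto simp: subalgebra_def)
  then show ?thesis
    using S P unfolding eval_npoly_def
    by (intro subspace_sum subspace_scale) (auto simp: subalgebra_def NA_def monomials_def)
qed

end

lemma eval_npoly_identity: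
  "free_alg.eval_npoly (\<lambda>i. Poly_Mapping.single (Gen i) 1) P = P"
  using free_alg.eval_npoly_unique[where h = "\<lambda>p. p" and I = UNIV and P = P]
  by (simp add: NA_def monomials_def)

lemma finite_gens: "finite (gens m)"
  by (induction m) auto

lemma gens_nonempty: "gens m \<noteq> {}"
  by (induction m) auto

context nonassoc_algebra
begin

text \<open>It is convenient to let the elements of \<open>\<alpha>\<close> be their own indeterminates. A polynomial in
  these involves finitely many of them; numbering those by \<open>1, \<dots>, n\<close> gives a polynomial to
  which the definition of algebraic independence applies, and undoing the numbering recovers the
  original one.\<close>

lemma alg_independent_eval_identity:
  assumes ind: "alg_independent \<alpha>" and P: "P \<in> NA \<alpha>" and zero: "eval_npoly (\<lambda>v. v) P = 0"
  shows "P = 0"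
proof (cases "P = 0")
  case False
  define I where "I = (\<Union>m\<in>Poly_Mapping.keys P. gens m)"
  have fin: "finite I" by (simp add: I_def finite_gens)
  have I_sub: "I \<subseteq> \<alpha>" and PI: "P \<in> NA I"
    using P by (auto simp: I_def NA_def monomials_def)
  obtain m where "m \<in> Poly_Mapping.keys P"
    using False by (metis ex_in_conv keys_eq_empty)
  then have "I \<noteq> {}" using gens_nonempty[of m] by (auto simp: I_def)
  then have n: "card I \<ge> 1" using fin by (simp add: Suc_leI card_gt_0_iff)
  obtain y where y: "bij_betw y {1..card I} I"
    using ex_bij_betw_nat_finite_1[OF fin] by blast
  define g where "g = inv_into {1..card I} y"
  have g: "g v \<in> {1..card I}" "y (g v) = v" if "v \<in> I" for v
    using that y bij_betw_inv_into_right[OF y] bij_betwE[OF bij_betw_inv_into[OF y]]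
    by (auto simp: g_def)
  define Q :: "(nat, 'f) npoly"
    where "Q = free_alg.eval_npoly (\<lambda>v. Poly_Mapping.single (Gen (g v)) 1) P"
  have "Q \<in> NA {1..card I}"
    unfolding Q_def using g(1)
    by (intro free_alg.eval_npoly_in_subalgebra[OF subalgebra_NA PI])
       (simp add: NA_def monomials_def)
  moreover have "eval_npoly y Q = eval_npoly (\<lambda>v. y (g v)) P"
    by (simp add: Q_def eval_npoly_substitute eval_npoly_Gen)
  then have "eval_npoly y Q = 0"
    using zero eval_npoly_cong[OF PI, of "\<lambda>v. y (g v)" "\<lambda>v. v"] g(2) by simp
  ultimately have "Q = 0"
    using ind n y I_sub unfolding alg_independent_def bij_betw_def by blast
  \<comment> \<open>Renaming back from \<open>i\<close> to \<open>y i\<close> turns \<open>Q\<close> into \<open>P\<close>.\<close>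
  have "free_alg.eval_npoly (\<lambda>i. Poly_Mapping.single (Gen (y i)) 1) Q
      = free_alg.eval_npoly (\<lambda>v. Poly_Mapping.single (Gen (y (g v))) 1) P"
    by (simp add: Q_def free_alg.eval_npoly_substitute free_alg.eval_npoly_Gen)
  also have "\<dots> = free_alg.eval_npoly (\<lambda>v. Poly_Mapping.single (Gen v) 1) P"
    by (rule free_alg.eval_npoly_cong[OF PI]) (simp add: g(2))
  finally show ?thesis
    using \<open>Q = 0\<close> by (simp add: eval_npoly_identity)
qed

lemma generated_eq_eval: "generated \<alpha> = eval_npoly (\<lambda>v. v) ` NA \<alpha>"
proof
  have NA: "free_alg.subalgebra (NA \<alpha> :: ('v, 'f) npoly set)" by (rule subalgebra_NA)
  show "generated \<alpha> \<subseteq> eval_npoly (\<lambda>v. v) ` NA \<alpha>"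
  proof (rule generated_minimal)
    show "\<alpha> \<subseteq> eval_npoly (\<lambda>v. v) ` NA \<alpha>"
    proof
      fix v assume "v \<in> \<alpha>"
      then have "Poly_Mapping.single (Gen v) 1 \<in> (NA \<alpha> :: ('v, 'f) npoly set)"
        by (simp add: NA_def monomials_def)
      then show "v \<in> eval_npoly (\<lambda>v. v) ` NA \<alpha>"
        by (rule rev_image_eqI) (simp add: eval_npoly_Gen)
    qed
    show "subalgebra (eval_npoly (\<lambda>v. v) ` NA \<alpha>)"
      unfolding subalgebra_def subspace_def
    proof (intro conjI ballI allI)
      show "0 \<in> eval_npoly (\<lambda>v. v) ` NA \<alpha>"
        by (rule image_eqI[of _ _ 0]) (simp_all add: NA_def)
    next
      fix x z assume "x \<in> eval_npoly (\<lambda>v. v) ` NA \<alpha>" "z \<in> eval_npoly (\<lambda>v. v) ` NA \<alpha>"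
      then obtain P Q where PQ: "P \<in> NA \<alpha>" "Q \<in> NA \<alpha>"
        "x = eval_npoly (\<lambda>v. v) P" "z = eval_npoly (\<lambda>v. v) Q" by blast
      have "P + Q \<in> NA \<alpha>" "nmult P Q \<in> NA \<alpha>"
        using NA PQ(1,2) by (auto simp: free_alg.subalgebra_def free_alg.subspace_def)
      then show "x + z \<in> eval_npoly (\<lambda>v. v) ` NA \<alpha>" "prd x z \<in> eval_npoly (\<lambda>v. v) ` NA \<alpha>"
        using PQ(3,4) by (metis eval_npoly_add image_eqI, metis eval_npoly_nmult image_eqI)
    next
      fix c x assume "x \<in> eval_npoly (\<lambda>v. v) ` NA \<alpha>"
      then obtain P where P: "P \<in> NA \<alpha>" "x = eval_npoly (\<lambda>v. v) P" by blast
      have "nscale c P \<in> NA \<alpha>"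
        using NA P(1) by (auto simp: free_alg.subalgebra_def free_alg.subspace_def)
      then show "scale c x \<in> eval_npoly (\<lambda>v. v) ` NA \<alpha>"
        using P(2) by (metis eval_npoly_nscale image_eqI)
    qed
  qed
  show "eval_npoly (\<lambda>v. v) ` NA \<alpha> \<subseteq> generated \<alpha>"
  proof (rule image_subsetI)
    fix P :: "('v, 'f) npoly" assume "P \<in> NA \<alpha>"
    then show "eval_npoly (\<lambda>v. v) P \<in> generated \<alpha>"
      by (rule eval_npoly_in_subalgebra[OF subalgebra_generated])
         (rule subsetD[OF generated_superset])
  qed
qed

text \<open>A product of two polynomials has no linear terms, since no generator is a product in the
  free magma.\<close>

lemma square_generated_eval:
  assumes "x \<in> square (generated \<alpha>)"
  obtains P where "P \<in> NA \<alpha>" "\<And>v. Poly_Mapping.lookup P (Gen v) = 0" "x = eval_npoly (\<lambda>v. v) P"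
proof -
  have NA: "free_alg.subalgebra (NA \<alpha> :: ('v, 'f) npoly set)" by (rule subalgebra_NA)
  have "\<exists>P. P \<in> NA \<alpha> \<and> (\<forall>v. Poly_Mapping.lookup P (Gen v) = 0) \<and> x = eval_npoly (\<lambda>v. v) P"
    using assms unfolding square_def
  proof (induction rule: span_induct_alt)
    case base
    show ?case by (rule exI[of _ 0]) (simp add: NA_def)
  next
    case (step c x z)
    obtain Q R where QR: "Q \<in> NA \<alpha>" "R \<in> NA \<alpha>"
      "x = prd (eval_npoly (\<lambda>v. v) Q) (eval_npoly (\<lambda>v. v) R)"
      using step.hyps(1) by (auto simp: generated_eq_eval)
    obtain P where P: "P \<in> NA \<alpha>" "\<forall>v. Poly_Mapping.lookup P (Gen v) = 0" "z = eval_npoly (\<lambda>v. v) P"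
      using step.IH by blast
    have "nscale c (nmult Q R) + P \<in> NA \<alpha>"
      using NA QR(1,2) P(1) by (auto simp: free_alg.subalgebra_def free_alg.subspace_def)
    then show ?case
      using P(2,3) QR(3)
      by (intro exI[of _ "nscale c (nmult Q R) + P"])
         (simp add: lookup_add eval_npoly_add eval_npoly_nscale eval_npoly_nmult)
  qed
  then show thesis using that by blast
qed

text \<open>If \<open>\<Sum>t\<in>T. c t \<cdot> t\<close> is the value of a polynomial \<open>P\<close> without linear terms, then
  \<open>\<Sum>t\<in>T. c t \<cdot> X\<^sub>t - P\<close> is a relation, hence zero, and its linear coefficients are the
  \<open>c t\<close>.\<close>

lemma alg_independent_imp_independent_mod_square:
  assumes ind: "alg_independent \<alpha>"
  shows "independent_mod (square (generated \<alpha>)) \<alpha>"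
  unfolding independent_mod_def
proof (intro allI impI ballI)
  fix T c t
  assume T: "finite T \<and> T \<subseteq> \<alpha> \<and> (\<Sum>t\<in>T. scale (c t) t) \<in> square (generated \<alpha>)" and t: "t \<in> T"
  then obtain P where P: "P \<in> NA \<alpha>" "\<And>v. Poly_Mapping.lookup P (Gen v) = 0"
    "(\<Sum>t\<in>T. scale (c t) t) = eval_npoly (\<lambda>v. v) P"
    using square_generated_eval by blast
  define L where "L = (\<Sum>t\<in>T. Poly_Mapping.single (Gen t) (c t))"
  have NA: "free_alg.subspace (NA \<alpha> :: ('v, 'f) npoly set)"
    using subalgebra_NA by (auto simp: free_alg.subalgebra_def)
  have "L \<in> NA \<alpha>"
    unfolding L_def using T by (intro free_alg.subspace_sum[OF NA]) (auto simp: NA_def monomials_def)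
  then have "L - P \<in> NA \<alpha>"
    using free_alg.subspace_diff[OF NA] P(1) by blast
  moreover have "eval_npoly (\<lambda>v. v) L = eval_npoly (\<lambda>v. v) (L - P) + eval_npoly (\<lambda>v. v) P"
    by (simp flip: eval_npoly_add)
  then have "eval_npoly (\<lambda>v. v) (L - P) = 0"
    using P(3) by (simp add: L_def eval_npoly_sum eval_npoly_single)
  ultimately have "L - P = 0"
    by (rule alg_independent_eval_identity[OF ind])
  then have "Poly_Mapping.lookup L (Gen t) = 0"
    using P(2) by simp
  then show "c t = 0"
    using T t by (simp add: L_def lookup_sum lookup_single when_def)
qed

end

section \<open>A linear criterion for algebraic independence\<close>

text \<open>Injectivity of the product on the tensor square: a sum of tensors \<open>u k \<otimes> q k\<close> with linearly
  independent \<open>u k\<close> vanishes only if all \<open>q k\<close> do. Unique factorisation in the magma makes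
  the coefficient of \<open>Mul m n\<close> in a product equal to the product of the coefficients of \<open>m\<close> and
  \<open>n\<close>; fixing \<open>n\<close> and varying \<open>m\<close> gives a linear relation among the \<open>u k\<close>. Independence is
  that of an indexed family, as the \<open>u k\<close> are not assumed to be distinct.\<close>

lemma nmult_sum_eq_0:
  assumes fin: "finite K"
    and ind: "\<And>c. (\<Sum>k\<in>K. nscale (c k) (u k)) = 0 \<Longrightarrow> \<forall>k\<in>K. c k = 0"
    and zero: "(\<Sum>k\<in>K. nmult (u k) (q k)) = 0"
    and k: "k \<in> K"
  shows "q k = 0"
proof (rule poly_mapping_eqI)
  fix n
  have "(\<Sum>k\<in>K. nscale (Poly_Mapping.lookup (q k) n) (u k)) = 0"
  proof (rule poly_mapping_eqI)
    fix m
    have "Poly_Mapping.lookup (\<Sum>k\<in>K. nscale (Poly_Mapping.lookup (q k) n) (u k)) m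
        = Poly_Mapping.lookup (\<Sum>k\<in>K. nmult (u k) (q k)) (Mul m n)"
      by (simp add: lookup_sum mult.commute)
    then show "Poly_Mapping.lookup (\<Sum>k\<in>K. nscale (Poly_Mapping.lookup (q k) n) (u k)) m
        = Poly_Mapping.lookup 0 m"
      using zero by simp
  qed
  from ind[OF this] k show "Poly_Mapping.lookup (q k) n = Poly_Mapping.lookup 0 n" by simp
qed

text \<open>Induction on the degree bound. A relation among the values of monomials is the sum of a
  linear combination of \<open>\<alpha>\<close> and an element of \<open>\<langle>\<alpha>\<rangle>\<^sup>2\<close>, so both parts vanish. The second part,
  grouped by left factors \<open>m\<close>, is \<open>\<Sum>m. m(y) q\<^sub>m\<close> where \<open>q\<^sub>m\<close> combines values of right factors.
  Left factors have smaller degree, so their values are independent and all \<open>q\<^sub>m\<close> vanish; right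
  factors have smaller degree too, so the coefficients in each \<open>q\<^sub>m\<close> vanish.\<close>

lemma eval_monomials_independent:
  fixes y :: "'i \<Rightarrow> ('a, 'f::field) npoly"
  assumes ind: "free_alg.independent_mod (free_alg.square (free_alg.generated \<alpha>)) \<alpha>"
    and inj: "inj_on y I" and y: "y ` I \<subseteq> \<alpha>"
    and K: "finite K" "K \<subseteq> monomials I" "\<And>m. m \<in> K \<Longrightarrow> mdeg m \<le> N"
    and zero: "(\<Sum>m\<in>K. nscale (c m) (free_alg.eval_monomial y m)) = 0"
    and m: "m \<in> K"
  shows "c m = 0"
  using K zero m
proof (induction N arbitrary: K c m)
  case 0
  then show ?case using mdeg_pos[of m] by (metis not_one_le_zero order_trans)
next
  case (Suc N)
  let ?e = "free_alg.eval_monomial y"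
  define J where "J = {i. Gen i \<in> K}"
  define K1 where "K1 = {m. \<exists>n. Mul m n \<in> K}"
  define K2 where "K2 = {n. \<exists>m. Mul m n \<in> K}"
  \<comment> \<open>The grouped sum runs over all of \<open>K1 \<times> K2\<close>, so \<open>d\<close> extends \<open>c\<close> by zero to products of a
    left and a right factor that do not occur in \<open>K\<close>.\<close>
  define d where "d m n = (if Mul m n \<in> K then c (Mul m n) else 0)" for m n
  define q where "q m = (\<Sum>n\<in>K2. nscale (d m n) (?e n))" for m
  have finJ: "finite J"
  proof -
    have "Gen ` J \<subseteq> K" by (auto simp: J_def)
    then show ?thesis using Suc.prems(1) by (meson finite_subset finite_imageD inj_onI magma.inject(1))
  qed
  have "K1 \<subseteq> (\<lambda>k. case k of Mul m n \<Rightarrow> m | Gen a \<Rightarrow> k) ` K"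
    unfolding K1_def by force
  then have fin1: "finite K1" using Suc.prems(1) finite_surj by blast
  have "K2 \<subseteq> (\<lambda>k. case k of Mul m n \<Rightarrow> n | Gen a \<Rightarrow> k) ` K"
    unfolding K2_def by force
  then have fin2: "finite K2" using Suc.prems(1) finite_surj by blast
  have sub: "K1 \<subseteq> monomials I" "K2 \<subseteq> monomials I" "J \<subseteq> I"
    using Suc.prems(2) by (force simp: K1_def K2_def J_def monomials_def)+
  have deg: "mdeg m \<le> N \<and> mdeg n \<le> N" if "Mul m n \<in> K" for m n
    using Suc.prems(3)[OF that] mdeg_pos[of m] mdeg_pos[of n] by simp
  have e_gen: "?e m \<in> free_alg.generated \<alpha>" if "m \<in> monomials I" for m
    using that y free_alg.generated_superset[of \<alpha>] free_alg.subalgebra_generated[of \<alpha>]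
    by (induction m) (auto simp: monomials_def free_alg.subalgebra_def)
  have K_eq: "K = Gen ` J \<union> (K \<inter> range (case_prod Mul))"
  proof -
    have "m \<in> Gen ` J \<union> (K \<inter> range (case_prod Mul))" if "m \<in> K" for m
      using that by (cases m) (auto simp: J_def)
    then show ?thesis by (auto simp: J_def)
  qed
  let ?M = "{(m, n). Mul m n \<in> K}"
  have split: "(\<Sum>m\<in>K. nscale (c m) (?e m))
      = (\<Sum>i\<in>J. nscale (c (Gen i)) (y i)) + (\<Sum>m\<in>K1. nmult (?e m) (q m))"
  proof -
    have img: "K \<inter> range (case_prod Mul) = case_prod Mul ` ?M" by auto
    have finM: "finite ?M"
    proof (rule finite_subset)
      show "?M \<subseteq> K1 \<times> K2" by (auto simp: K1_def K2_def)
    qed (simp add: fin1 fin2)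
    have "(\<Sum>m\<in>K. nscale (c m) (?e m)) = (\<Sum>m\<in>Gen ` J. nscale (c m) (?e m))
        + (\<Sum>m\<in>case_prod Mul ` ?M. nscale (c m) (?e m))"
      by (subst K_eq, unfold img, rule sum.union_disjoint) (use finJ finM in auto)
    also have "(\<Sum>m\<in>Gen ` J. nscale (c m) (?e m)) = (\<Sum>i\<in>J. nscale (c (Gen i)) (y i))"
      by (subst sum.reindex) (auto simp: inj_on_def)
    also have "(\<Sum>m\<in>case_prod Mul ` ?M. nscale (c m) (?e m))
        = (\<Sum>(m, n)\<in>?M. nscale (d m n) (nmult (?e m) (?e n)))"
      by (subst sum.reindex) (auto simp: inj_on_def d_def intro!: sum.cong)
    also have "\<dots> = (\<Sum>(m, n)\<in>K1 \<times> K2. nscale (d m n) (nmult (?e m) (?e n)))"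
      using fin1 fin2
      by (intro sum.mono_neutral_left) (auto simp: K1_def K2_def d_def split: if_splits)
    also have "\<dots> = (\<Sum>m\<in>K1. nmult (?e m) (q m))"
      by (simp add: sum.cartesian_product[symmetric] q_def free_alg.prd_sum_right
          free_alg.prd_scale_right)
    finally show ?thesis .
  qed
  have q_gen: "q m \<in> free_alg.generated \<alpha>" for m
    unfolding q_def using free_alg.subalgebra_generated[of \<alpha>] sub(2) e_gen
    by (intro free_alg.subspace_sum free_alg.subspace_scale) (auto simp: free_alg.subalgebra_def)
  have sq: "(\<Sum>m\<in>K1. nmult (?e m) (q m)) \<in> free_alg.square (free_alg.generated \<alpha>)"
    using sub(1) e_gen q_gen
    by (intro free_alg.subspace_sum free_alg.subspace_square free_alg.prd_in_square) auto
  \<comment> \<open>Independence modulo a subspace speaks of a set of vectors, so the coefficients have to be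
    indexed by the distinct values \<open>y i\<close> instead of by \<open>i\<close>.\<close>
  have injJ: "inj_on y J" using inj sub(3) inj_on_subset by blast
  have yJ: "(\<Sum>v\<in>y ` J. nscale (c (Gen (inv_into J y v))) v) = (\<Sum>i\<in>J. nscale (c (Gen i)) (y i))"
    using injJ by (simp add: sum.reindex)
  have "(\<Sum>i\<in>J. nscale (c (Gen i)) (y i)) = - (\<Sum>m\<in>K1. nmult (?e m) (q m))"
    using Suc.prems(4) split by (simp add: eq_neg_iff_add_eq_0)
  then have "(\<Sum>i\<in>J. nscale (c (Gen i)) (y i)) \<in> free_alg.square (free_alg.generated \<alpha>)"
    using free_alg.subspace_neg[OF free_alg.subspace_square sq] by simp
  then have cJ: "c (Gen i) = 0" if "i \<in> J" for i
    using free_alg.independent_modD[OF ind, of "y ` J" "\<lambda>v. c (Gen (inv_into J y v))" "y i"]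
      finJ sub(3) y injJ that unfolding yJ by (auto simp: inv_into_f_f)
  then have prod0: "(\<Sum>m\<in>K1. nmult (?e m) (q m)) = 0"
    using Suc.prems(4) split by simp
  have q0: "q m = 0" if "m \<in> K1" for m
  proof (rule nmult_sum_eq_0[OF fin1 _ prod0 that])
    fix b assume "(\<Sum>m\<in>K1. nscale (b m) (?e m)) = 0"
    then show "\<forall>m\<in>K1. b m = 0"
      using Suc.IH[of K1 b] fin1 sub(1) deg by (auto simp: K1_def)
  qed
  show ?case
  proof (cases m)
    case (Gen i)
    then show ?thesis using cJ Suc.prems(5) by (simp add: J_def)
  next
    case (Mul m1 m2)
    then have "m1 \<in> K1" "m2 \<in> K2" using Suc.prems(5) by (auto simp: K1_def K2_def)
    moreover have "d m1 m2 = 0"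
      using Suc.IH[of K2 "d m1" m2] fin2 sub(2) deg q0[OF \<open>m1 \<in> K1\<close>] \<open>m2 \<in> K2\<close>
      by (auto simp: K2_def q_def)
    ultimately show ?thesis
      using Mul Suc.prems(5) by (simp add: d_def)
  qed
qed

lemma independent_mod_square_imp_alg_independent:
  fixes \<alpha> :: "('a, 'f::field) npoly set"
  assumes "free_alg.independent_mod (free_alg.square (free_alg.generated \<alpha>)) \<alpha>"
  shows "free_alg.alg_independent \<alpha>"
  unfolding free_alg.alg_independent_def
proof (intro allI impI ballI)
  fix n :: nat and y :: "nat \<Rightarrow> ('a, 'f) npoly" and P
  assume y: "inj_on y {1..n} \<and> y ` {1..n} \<subseteq> \<alpha>"
    and P: "P \<in> NA {1..n}" and zero: "free_alg.eval_npoly y P = 0"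
  have *: "Poly_Mapping.lookup P m = 0" if "m \<in> Poly_Mapping.keys P" for m
  proof (rule eval_monomials_independent[OF assms])
    show "inj_on y {1..n}" "y ` {1..n} \<subseteq> \<alpha>" using y by auto
    show "finite (Poly_Mapping.keys P)" by simp
    show "Poly_Mapping.keys P \<subseteq> monomials {1..n}" using P by (simp add: NA_def)
    show "mdeg m \<le> Max (mdeg ` Poly_Mapping.keys P)" if "m \<in> Poly_Mapping.keys P" for m
      using that by simp
    show "(\<Sum>m\<in>Poly_Mapping.keys P. nscale (Poly_Mapping.lookup P m)
        (free_alg.eval_monomial y m)) = 0"
      using zero by (simp add: free_alg.eval_npoly_def)
  qed (fact that)
  show "P = 0"
    by (rule poly_mapping_eqI) (use * in \<open>auto simp: in_keys_iff\<close>)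
qed

section \<open>Homogeneous components\<close>

lemma hproj_add: "hproj n (p + q) = hproj n p + hproj n q"
  by (rule poly_mapping_eqI) (simp add: lookup_hproj lookup_add)

lemma hproj_nscale: "hproj n (nscale c p) = nscale c (hproj n p)"
  by (rule poly_mapping_eqI) (simp add: lookup_hproj)

lemma hproj_0: "hproj n 0 = 0"
  by (rule poly_mapping_eqI) (simp add: lookup_hproj)

lemma hproj_span:
  assumes p: "p \<in> free_alg.span G" and V: "free_alg.subspace V"
    and G: "\<And>g. g \<in> G \<Longrightarrow> hproj n g \<in> V"
  shows "hproj n p \<in> V"
  using p
proof (induction rule: free_alg.span_induct_alt)
  case base
  show ?case using V by (simp add: hproj_0 free_alg.subspace_0)
next
  case (step c x y)
  then show ?case
    using V G by (simp add: hproj_add hproj_nscale free_alg.subspace_add free_alg.subspace_scale)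
qed

lemma hproj_nmult:
  "hproj n (nmult p q) = (\<Sum>i\<in>{1..<n}. nmult (hproj i p) (hproj (n - i) q))"
proof (rule poly_mapping_eqI)
  fix k
  show "Poly_Mapping.lookup (hproj n (nmult p q)) k
      = Poly_Mapping.lookup (\<Sum>i\<in>{1..<n}. nmult (hproj i p) (hproj (n - i) q)) k"
  proof (cases k)
    case (Gen a)
    then show ?thesis by (simp add: lookup_hproj lookup_sum)
  next
    case (Mul m1 m2)
    have "(\<Sum>i\<in>{1..<n}. Poly_Mapping.lookup (hproj i p) m1 * Poly_Mapping.lookup (hproj (n - i) q) m2)
        = (\<Sum>i\<in>{1..<n}. if i = mdeg m1 then
            (if mdeg m2 = n - i then Poly_Mapping.lookup p m1 * Poly_Mapping.lookup q m2 else 0)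
            else 0)"
      by (rule sum.cong) (auto simp: lookup_hproj)
    also have "\<dots> = (if mdeg m1 + mdeg m2 = n
        then Poly_Mapping.lookup p m1 * Poly_Mapping.lookup q m2 else 0)"
      using mdeg_pos[of m1] mdeg_pos[of m2] by (auto simp: sum.delta)
    finally show ?thesis
      using Mul by (simp add: lookup_hproj lookup_sum)
  qed
qed

text \<open>The component of degree \<open>n\<close> of a product only involves components of the factors of degree
  between \<open>1\<close> and \<open>n - 1\<close>, because there is nothing in degree \<open>0\<close>. This is what makes
  inductions on the degree work.\<close>

lemma hproj_square:
  assumes p: "p \<in> free_alg.square S"
    and low: "\<And>i x. \<lbrakk>x \<in> S; 1 \<le> i; i < n\<rbrakk> \<Longrightarrow> hproj i x \<in> B"
  shows "hproj n p \<in> free_alg.square B"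
  using p unfolding free_alg.square_def[of S]
proof (rule hproj_span[OF _ free_alg.subspace_square])
  fix g assume "g \<in> {nmult x y | x y. x \<in> S \<and> y \<in> S}"
  then obtain x y where g: "g = nmult x y" "x \<in> S" "y \<in> S" by blast
  show "hproj n g \<in> free_alg.square B"
    unfolding g(1) hproj_nmult using g(2,3)
    by (intro free_alg.subspace_sum free_alg.subspace_square free_alg.prd_in_square low) auto
qed

lemma sum_hproj:
  assumes "\<And>m. m \<in> Poly_Mapping.keys p \<Longrightarrow> mdeg m \<le> N"
  shows "p = (\<Sum>n=1..N. hproj n p)"
proof (rule poly_mapping_eqI)
  fix m
  have "Poly_Mapping.lookup p m = 0 \<or> mdeg m \<le> N"
    using assms by (auto simp: in_keys_iff)
  then show "Poly_Mapping.lookup p m = Poly_Mapping.lookup (\<Sum>n=1..N. hproj n p) m"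
    using mdeg_pos[of m] by (auto simp: lookup_sum lookup_hproj)
qed

lemma mdeg_le_pdeg: "m \<in> Poly_Mapping.keys p \<Longrightarrow> mdeg m \<le> pdeg p"
  by (simp add: pdeg_def)

lemma pdeg_hproj: "hproj n p \<noteq> 0 \<Longrightarrow> pdeg (hproj n p) = n"
proof -
  assume nz: "hproj n p \<noteq> 0"
  have "mdeg m = n" if "m \<in> Poly_Mapping.keys (hproj n p)" for m
    using that by (auto simp: in_keys_iff lookup_hproj split: if_splits)
  moreover obtain m where "m \<in> Poly_Mapping.keys (hproj n p)"
    using nz by (metis ex_in_conv keys_eq_empty)
  ultimately have "mdeg ` Poly_Mapping.keys (hproj n p) = {n}" by (auto intro: rev_image_eqI)
  then show ?thesis by (simp add: pdeg_def)
qed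

lemma HA_keys:
  assumes "p \<in> HA k A" "m \<in> Poly_Mapping.keys p"
  shows "mdeg m = k"
proof -
  have "HA k A \<subseteq> {p. \<forall>m. mdeg m \<noteq> k \<longrightarrow> Poly_Mapping.lookup p m = 0}"
    unfolding HA_def
    by (rule free_alg.span_minimal)
       (auto simp: free_alg.subspace_def lookup_add lookup_single when_def)
  then show ?thesis using assms by (auto simp: in_keys_iff)
qed

lemma hproj_homogeneous:
  assumes "homogeneous_poly A p"
  shows "hproj n p = p \<or> hproj n p = 0"
proof -
  obtain k where k: "p \<in> HA k A" using assms by (auto simp: homogeneous_poly_def)
  have "Poly_Mapping.lookup p m = 0" if "mdeg m \<noteq> k" for m
    using HA_keys[OF k, of m] that by (auto simp: in_keys_iff)
  then have "hproj n p = (if n = k then p else 0)"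
    by (intro poly_mapping_eqI) (auto simp: lookup_hproj)
  then show ?thesis by simp
qed

lemma bounded_degree_pdeg_le:
  assumes "bounded_degree T" "p \<in> T" "p \<noteq> 0"
  shows "pdeg p \<le> set_deg T"
proof -
  let ?Q = "\<lambda>N. N \<ge> 1 \<and> (\<forall>p\<in>T. p \<noteq> 0 \<longrightarrow> pdeg p \<le> N)"
  have "\<exists>N. ?Q N"
    using assms(1) by (simp add: bounded_degree_def)
  then have "?Q (LEAST N. ?Q N)"
    by (rule LeastI_ex)
  moreover have "set_deg T = (LEAST N. ?Q N)"
    using assms(2) by (auto simp: set_deg_def)
  ultimately show ?thesis using assms(2,3) by metis
qed

section \<open>Homogeneous subalgebras\<close>

text \<open>A linear combination of \<open>\<beta>\<close> has degree at most \<open>N\<close>. If it lies in \<open>S\<^sup>2\<close>, it is the sum of the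
  components of degree at most \<open>N\<close> of an element of \<open>S\<^sup>2\<close>; these only involve factors from
  \<open>S\<close> of degree less than \<open>N\<close>, which \<open>\<beta>\<close> generates. So the combination lies in
  \<open>\<langle>\<beta>\<rangle>\<^sup>2\<close>.\<close>

lemma independent_mod_square_subalgebra:
  assumes S: "homogeneous_subalgebra A S"
    and ind: "free_alg.alg_independent \<beta>"
    and deg: "\<And>p. \<lbrakk>p \<in> \<beta>; p \<noteq> 0\<rbrakk> \<Longrightarrow> pdeg p \<le> N"
    and low: "{p \<in> S. p \<noteq> 0 \<and> pdeg p \<le> N} \<subseteq> free_alg.generated \<beta>"
  shows "free_alg.independent_mod (free_alg.square S) \<beta>"
  unfolding free_alg.independent_mod_def
proof (intro allI impI ballI)
  fix T c t
  assume T: "finite T \<and> T \<subseteq> \<beta> \<and> (\<Sum>t\<in>T. nscale (c t) t) \<in> free_alg.square S" and t: "t \<in> T"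
  let ?p = "\<Sum>t\<in>T. nscale (c t) t"
  have "mdeg m \<le> N" if m: "m \<in> Poly_Mapping.keys ?p" for m
  proof (rule ccontr)
    assume "\<not> mdeg m \<le> N"
    have "Poly_Mapping.lookup t m = 0" if "t \<in> T" for t
    proof (cases "t = 0")
      case False
      then have "pdeg t \<le> N" using that T deg by blast
      then show ?thesis
        using \<open>\<not> mdeg m \<le> N\<close> mdeg_le_pdeg[of m t] by (auto simp: in_keys_iff)
    qed simp
    then show False using m by (simp add: in_keys_iff lookup_sum)
  qed
  then have p_eq: "?p = (\<Sum>n=1..N. hproj n ?p)"
    by (rule sum_hproj)
  have low': "hproj i x \<in> free_alg.generated \<beta>" if "x \<in> S" "1 \<le> i" "i \<le> N" for i x
  proof (cases "hproj i x = 0")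
    case True
    then show ?thesis
      using free_alg.subalgebra_generated[of \<beta>]
      by (simp add: free_alg.subalgebra_def free_alg.subspace_0)
  next
    case False
    then show ?thesis
      using that S low pdeg_hproj[OF False] by (auto simp: homogeneous_subalgebra_def)
  qed
  have "(\<Sum>n=1..N. hproj n ?p) \<in> free_alg.square (free_alg.generated \<beta>)"
  proof (rule free_alg.subspace_sum[OF free_alg.subspace_square])
    fix n assume n: "n \<in> {1..N}"
    have "?p \<in> free_alg.square S" using T by blast
    then show "hproj n ?p \<in> free_alg.square (free_alg.generated \<beta>)"
      by (rule hproj_square) (rule low', use n in auto)
  qed
  then have "?p \<in> free_alg.square (free_alg.generated \<beta>)"
    using p_eq by simp
  then show "c t = 0"
    using free_alg.independent_modD[OF free_alg.alg_independent_imp_independent_mod_square[OF ind]]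
      T t by blast
qed

text \<open>A graded form of Nakayama's lemma: homogeneous elements that span \<open>S\<close> modulo \<open>S\<^sup>2\<close> generate
  \<open>S\<close>, by induction on the degree.\<close>

lemma generated_eq_homogeneous_subalgebra:
  assumes S: "homogeneous_subalgebra A S" and \<alpha>: "\<alpha> \<subseteq> S"
    and hom: "\<And>p. p \<in> \<alpha> \<Longrightarrow> homogeneous_poly A p"
    and span: "{p \<in> S. homogeneous_poly A p} \<subseteq> free_alg.span (\<alpha> \<union> free_alg.square S)"
  shows "free_alg.generated \<alpha> = S"
proof
  have alg: "free_alg.subalgebra S" using S by (simp add: homogeneous_subalgebra_def)
  show "free_alg.generated \<alpha> \<subseteq> S"
    by (rule free_alg.generated_minimal[OF \<alpha> alg])
  have gen: "free_alg.subalgebra (free_alg.generated \<alpha>)"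
    by (rule free_alg.subalgebra_generated)
  then have gen_sub: "free_alg.subspace (free_alg.generated \<alpha>)"
    by (simp add: free_alg.subalgebra_def)
  have comp: "hproj n p \<in> free_alg.generated \<alpha>" if "p \<in> S" "n \<ge> 1" for n p
    using that
  proof (induction n arbitrary: p rule: less_induct)
    case (less n)
    show ?case
    proof (cases "hproj n p = 0")
      case True
      then show ?thesis by (simp add: free_alg.subspace_0[OF gen_sub])
    next
      case False
      have "hproj n p \<in> S"
        using S less.prems by (simp add: homogeneous_subalgebra_def)
      moreover have "homogeneous_poly A (hproj n p)"
        unfolding homogeneous_poly_def
        using False less.prems S hproj_mem[of p A n] by (auto simp: homogeneous_subalgebra_def)
      \<comment> \<open>The expression of this component by elements of \<open>\<alpha>\<close> and products may involve other
        degrees; projecting once more to degree \<open>n\<close> removes them.\<close>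
      ultimately have "hproj n p \<in> free_alg.span (\<alpha> \<union> free_alg.square S)"
        using span by blast
      then have "hproj n (hproj n p) \<in> free_alg.generated \<alpha>"
      proof (rule hproj_span[OF _ gen_sub])
        fix g assume "g \<in> \<alpha> \<union> free_alg.square S"
        then show "hproj n g \<in> free_alg.generated \<alpha>"
        proof
          assume "g \<in> \<alpha>"
          then show ?thesis
            using hproj_homogeneous[OF hom, of g n] free_alg.generated_superset[of \<alpha>]
              free_alg.subspace_0[OF gen_sub] by auto
        next
          assume "g \<in> free_alg.square S"
          then have "hproj n g \<in> free_alg.square (free_alg.generated \<alpha>)"
            using less.IH by (rule hproj_square)
          then show ?thesis
            using free_alg.square_subset_subalgebra[OF gen] by blast
        qed
      qed
      moreover have "hproj n (hproj n p) = hproj n p"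
        by (rule poly_mapping_eqI) (simp add: lookup_hproj)
      ultimately show ?thesis by simp
    qed
  qed
  show "S \<subseteq> free_alg.generated \<alpha>"
  proof
    fix p assume "p \<in> S"
    then have "(\<Sum>n=1..pdeg p. hproj n p) \<in> free_alg.generated \<alpha>"
      using comp by (intro free_alg.subspace_sum[OF gen_sub]) auto
    then show "p \<in> free_alg.generated \<alpha>"
      using sum_hproj[of p "pdeg p", OF mdeg_le_pdeg] by simp
  qed
qed

theorem theorem6:
  fixes A :: "'a set" and S \<alpha>\<^sub>S :: "('a, 'f::field) npoly set"
  assumes "A \<noteq> {}"
    and "homogeneous_subalgebra A S"
    and "\<alpha>\<^sub>S \<subseteq> S"
    and "free_alg.alg_independent \<alpha>\<^sub>S"
    and "\<forall>p\<in>\<alpha>\<^sub>S. homogeneous_poly A p"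
    and "bounded_degree \<alpha>\<^sub>S"
    and "{p \<in> S. p \<noteq> 0 \<and> pdeg p \<le> set_deg \<alpha>\<^sub>S} \<subseteq> free_alg.generated \<alpha>\<^sub>S"
  shows "\<exists>\<alpha>. \<alpha> \<subseteq> S \<and> free_alg.alg_independent \<alpha> \<and> (\<forall>p\<in>\<alpha>. homogeneous_poly A p) \<and>
           \<alpha>\<^sub>S \<subseteq> \<alpha> \<and> free_alg.generated \<alpha> = S"
proof -
  have alg: "free_alg.subalgebra S"
    using assms(2) by (simp add: homogeneous_subalgebra_def)
  have "free_alg.independent_mod (free_alg.square S) \<alpha>\<^sub>S"
    using independent_mod_square_subalgebra[OF assms(2,4) bounded_degree_pdeg_le[OF assms(6)] assms(7)] .
  moreover have "\<alpha>\<^sub>S \<subseteq> {p \<in> S. homogeneous_poly A p}"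
    using assms(3,5) by blast
  ultimately obtain \<alpha> where \<alpha>: "\<alpha>\<^sub>S \<subseteq> \<alpha>" "\<alpha> \<subseteq> {p \<in> S. homogeneous_poly A p}"
    "free_alg.independent_mod (free_alg.square S) \<alpha>"
    "{p \<in> S. homogeneous_poly A p} \<subseteq> free_alg.span (\<alpha> \<union> free_alg.square S)"
    by (rule free_alg.independent_mod_extend[OF free_alg.subspace_square])
  have gen: "free_alg.generated \<alpha> = S"
    using \<alpha>(2,4) by (intro generated_eq_homogeneous_subalgebra[OF assms(2)]) auto
  have "free_alg.alg_independent \<alpha>"
    using \<alpha>(3) gen by (intro independent_mod_square_imp_alg_independent) simp
  with \<alpha>(1,2) gen show ?thesis by blast
qed

end
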